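(* Let $\mathbb{F}_q$ be a finite field of odd characteristic, let $a,d\in\mathbb{F}_q$ with $ad(a-d)\neq 0$, let $E_{a,d}$ be the twisted Edwards curve $ax^2+y^2=1+dx^2y^2$, and let $w(x,y)=dx^2y^2$ on affine points and $w=\infty$ at the points at infinity. Put $e=4a/d$. Let $P_1,P_2\in E_{a,d}(\mathbb{F}_q)$, suppose that $w_0:=w(P_2-P_1)\in\mathbb{F}_q\setminus\{0\}$ (the difference is given in affine form), and let $(W_i,Z_i)\in\mathbb{F}_q^2\setminus\{(0,0)\}$ satisfy $w(P_i)=W_i/Z_i$ for $i=1,2$. Set $$A_1=W_1+Z_1,\quad B_1=W_1-Z_1,\quad A_2=W_2+Z_2,\quad B_2=W_2-Z_2,\quad C=A_1B_2,\quad D=A_2B_1,$$ $$W_3=(C-D)^2,\qquad Z_3=w_0(C+D)^2,$$ and compute $(W_4,Z_4)$ in any one of the following ways: (i) $E=A_1^2-B_1^2$, $W_4=E\left(A_1^2-\tfrac{e}{4}E\right)$, $Z_4=A_1^2B_1^2$; (ii) $E=A_1^2-B_1^2$, $F=(A_1^4+B_1^4)-E^2$, $W_4=2\left(A_1^4-\tfrac e4E^2\right)-F$, $Z_4=F$; (iii) if $e(e-4)$ is a nonzero square in $\mathbb{F}_q$ (equivalently $\chi(a(a-d))=1$), with $r\in\mathbb{F}_q$ such that $r^2=(e-4)/e$: $H_1=(rA_1^2+B_1^2)^2$, $H_2=(rA_1^2-B_1^2)^2$, $G=H_1+H_2$, $K=H_1-H_2$, $S=\tfrac1rK$, $T=rK$,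 $W_4=2G-S-T$, $Z_4=T-S$. Then in each case $w(2P_1)=W_4/Z_4$ and $w(P_1+P_2)=W_3/Z_3$ (neither pair being $(0,0)$). The total cost of computing $(W_3,Z_3)$ and $(W_4,Z_4)$ from $w_0,W_1,Z_1,W_2,Z_2$ is $5\mathbf{M}+4\mathbf{S}+1\mathbf{D}$ in case (i), $3\mathbf{M}+7\mathbf{S}+1\mathbf{D}$ in case (ii), and $3\mathbf{M}+6\mathbf{S}+3\mathbf{D}$ in case (iii).
   Context: $\chi$ denotes the quadratic character of $\mathbb{F}_q$. $\mathbf{M}$, $\mathbf{S}$, $\mathbf{D}$ denote the cost of one multiplication in $\mathbb{F}_q$, one squaring in $\mathbb{F}_q$, and one multiplication by a curve constant (here $e/4$, or $r$ and $1/r$); additions, subtractions and multiplications by the integer $2$ are not counted. The nonsingular model of $E_{a,d}$ is the curve in $\mathbb{P}^3$ of points $(X:Y:T:Z)$ with $aX^2+Y^2=Z^2+dT^2$ and $XY=ZT$; an affine point $(x,y)$ corresponds to $(x:y:xy:1)$. The points with $Z=0$ ("points at infinity") are $(0:\pm\sqrt d:1:0)$ and $(1:0:\pm\sqrt{a/d}:0)$, when rational. $E_{a,d}(\mathbb{F}_q)$ is the set of $\mathbb{F}_q$-rational points of this model; it is a group with neutral element $\mathcal{O}=(0,1)$, $-(x,y)=(-x,y)$ (in $\mathbb{P}^3$: $-(X:Y:T:Z)=(-X:Y:-T:Z)$), whose (elliptic curve) group law is given on affine points, whenever the denominators are nonzero, by $(x_1,y_1)+(x_2,y_2)=\left(\frac{x_1y_2+x_2y_1}{1+dx_1x_2y_1y_2},\frac{y_1y_2-ax_1x_2}{1-dx_1x_2y_1y_2}\right)$.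 $W/Z$ means the quotient in $\mathbb{F}_q$ if $Z\ne0$, it means $\infty$ if $W\neq0$ and $Z=0$, and it is undefined if $W=Z=0$. *)

theory Defs
  imports Complex_Main
begin

section \<open>Points of projective 3-space\<close>

definition proj3_rel :: "'a::field \<times> 'a \<times> 'a \<times> 'a \<Rightarrow> 'a \<times> 'a \<times> 'a \<times> 'a \<Rightarrow> bool" where
  "proj3_rel = (\<lambda>(X, Y, T, Z) (X', Y', T', Z').
     (X, Y, T, Z) \<noteq> (0, 0, 0, 0) \<and>
     (\<exists>c. c \<noteq> 0 \<and> X' = c * X \<and> Y' = c * Y \<and> T' = c * T \<and> Z' = c * Z))"

lemma proj3_relI:
  "(X, Y, T, Z) \<noteq> (0, 0, 0, 0) \<Longrightarrow> c \<noteq> 0 \<Longrightarrow> X' = c * X \<Longrightarrow> Y' = c * Y \<Longrightarrow>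
   T' = c * T \<Longrightarrow> Z' = c * Z \<Longrightarrow> proj3_rel (X, Y, T, Z) (X', Y', T', Z')"
  unfolding proj3_rel_def by auto

lemma proj3_relE:
  assumes "proj3_rel (X, Y, T, Z) (X', Y', T', Z')"
  obtains c where "c \<noteq> 0" "X' = c * X" "Y' = c * Y" "T' = c * T" "Z' = c * Z"
    "(X, Y, T, Z) \<noteq> (0, 0, 0, 0)"
  using assms unfolding proj3_rel_def by auto

lemma part_equivp_proj3_rel: "part_equivp (proj3_rel :: 'a::field \<times> 'a \<times> 'a \<times> 'a \<Rightarrow> _)"
proof (rule part_equivpI)
  have "proj3_rel (1, 0, 0, 0) (1::'a, 0, 0, 0)"
    by (rule proj3_relI[where c = 1]) auto
  then show "\<exists>v. proj3_rel v (v :: 'a \<times> 'a \<times> 'a \<times> 'a)" by blast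
  show "symp (proj3_rel :: 'a \<times> 'a \<times> 'a \<times> 'a \<Rightarrow> _)"
  proof (rule sympI)
    fix u v :: "'a \<times> 'a \<times> 'a \<times> 'a"
    assume "proj3_rel u v"
    moreover obtain X Y T Z where u: "u = (X, Y, T, Z)" by (cases u) auto
    moreover obtain X' Y' T' Z' where v: "v = (X', Y', T', Z')" by (cases v) auto
    ultimately obtain c where "c \<noteq> 0" "X' = c * X" "Y' = c * Y" "T' = c * T" "Z' = c * Z"
      "(X, Y, T, Z) \<noteq> (0, 0, 0, 0)" by (auto elim: proj3_relE)
    then show "proj3_rel v u"
      unfolding u v by (intro proj3_relI[where c = "inverse c"]) auto
  qed
  show "transp (proj3_rel :: 'a \<times> 'a \<times> 'a \<times> 'a \<Rightarrow> _)"
  proof (rule transpI)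
    fix u v w :: "'a \<times> 'a \<times> 'a \<times> 'a"
    assume *: "proj3_rel u v" "proj3_rel v w"
    obtain X Y T Z where u: "u = (X, Y, T, Z)" by (cases u) auto
    obtain X' Y' T' Z' where v: "v = (X', Y', T', Z')" by (cases v) auto
    obtain X'' Y'' T'' Z'' where w: "w = (X'', Y'', T'', Z'')" by (cases w) auto
    obtain c where c: "c \<noteq> 0" "X' = c * X" "Y' = c * Y" "T' = c * T" "Z' = c * Z"
      "(X, Y, T, Z) \<noteq> (0, 0, 0, 0)"
      using *(1) unfolding u v by (rule proj3_relE)
    obtain c' where c': "c' \<noteq> 0" "X'' = c' * X'" "Y'' = c' * Y'" "T'' = c' * T'" "Z'' = c' * Z'"
      using *(2) unfolding v w by (rule proj3_relE)
    show "proj3_rel u w"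
      unfolding u w using c c' by (intro proj3_relI[where c = "c' * c"]) auto
  qed
qed

quotient_type (overloaded) 'a proj3 = "'a::field \<times> 'a \<times> 'a \<times> 'a" / partial: proj3_rel
  by (rule part_equivp_proj3_rel)

section \<open>The nonsingular model of the twisted Edwards curve\<close>

lift_definition on_edwards :: "'a::field \<Rightarrow> 'a \<Rightarrow> 'a proj3 \<Rightarrow> bool"
  is "\<lambda>a d (X, Y, T, Z). a * X^2 + Y^2 = Z^2 + d * T^2 \<and> X * Y = Z * T"
proof -
  fix a d :: 'a and u v :: "'a \<times> 'a \<times> 'a \<times> 'a"
  assume *: "proj3_rel u v"
  obtain X Y T Z where u: "u = (X, Y, T, Z)" by (cases u) auto
  obtain X' Y' T' Z' where v: "v = (X', Y', T', Z')" by (cases v) auto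
  obtain c where c: "c \<noteq> 0" "X' = c * X" "Y' = c * Y" "T' = c * T" "Z' = c * Z"
    using * unfolding u v by (rule proj3_relE)
  have "a * X'^2 + Y'^2 = c^2 * (a * X^2 + Y^2)" "Z'^2 + d * T'^2 = c^2 * (Z^2 + d * T^2)"
    "X' * Y' = c^2 * (X * Y)" "Z' * T' = c^2 * (Z * T)"
    by (simp_all add: c algebra_simps power2_eq_square)
  then show "(case u of (X, Y, T, Z) \<Rightarrow> a * X^2 + Y^2 = Z^2 + d * T^2 \<and> X * Y = Z * T) =
    (case v of (X, Y, T, Z) \<Rightarrow> a * X^2 + Y^2 = Z^2 + d * T^2 \<and> X * Y = Z * T)"
    using c(1) by (simp add: u v)
qed

definition edwards_curve :: "'a::field \<Rightarrow> 'a \<Rightarrow> 'a proj3 set" where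
  "edwards_curve a d = {P. on_edwards a d P}"

lift_definition edwards_affine :: "'a::field \<Rightarrow> 'a \<Rightarrow> 'a proj3" is "\<lambda>x y. (x, y, x * y, 1)"
  by (rule proj3_relI[where c = 1]) auto

lift_definition edwards_neg :: "'a::field proj3 \<Rightarrow> 'a proj3"
  is "\<lambda>(X, Y, T, Z). (- X, Y, - T, Z)"
proof -
  fix u v :: "'a \<times> 'a \<times> 'a \<times> 'a"
  assume *: "proj3_rel u v"
  obtain X Y T Z where u: "u = (X, Y, T, Z)" by (cases u) auto
  obtain X' Y' T' Z' where v: "v = (X', Y', T', Z')" by (cases v) auto
  obtain c where "c \<noteq> 0" "X' = c * X" "Y' = c * Y" "T' = c * T" "Z' = c * Z"
    "(X, Y, T, Z) \<noteq> (0, 0, 0, 0)"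
    using * unfolding u v by (rule proj3_relE)
  then show "proj3_rel (case u of (X, Y, T, Z) \<Rightarrow> (- X, Y, - T, Z))
    (case v of (X, Y, T, Z) \<Rightarrow> (- X, Y, - T, Z))"
    by (auto simp: u v intro!: proj3_relI[where c = c])
qed

text \<open>
  The group law on all rational points, including those at infinity. The first law is the affine
  addition formula written in the coordinates \<open>(X : Y : T : Z)\<close>; the second one is the
  dual formula \<open>x = (x1 y1 + x2 y2) / (y1 y2 + a x1 x2)\<close>,
  \<open>y = (x1 y1 - x2 y2) / (x1 y2 - x2 y1)\<close> (Hisil, Wong, Carter, Dawson). Bernstein and
  Lange (A complete set of addition laws for incomplete Edwards curves) show that on the curve at
  least one of them yields a nonzero vector (see \<open>edwards_laws_complete\<close> below), that they
  agree when both do, and that the result is the elliptic curve group law. The last branch of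
  \<open>edwards_add_coords\<close> is therefore only reached for points off the curve.
\<close>

fun edwards_law1 :: "'a::field \<Rightarrow> 'a \<Rightarrow> 'a \<times> 'a \<times> 'a \<times> 'a \<Rightarrow> 'a \<times> 'a \<times> 'a \<times> 'a
    \<Rightarrow> 'a \<times> 'a \<times> 'a \<times> 'a" where
  "edwards_law1 a d (X1, Y1, T1, Z1) (X2, Y2, T2, Z2) =
     ((X1 * Y2 + X2 * Y1) * (Z1 * Z2 - d * T1 * T2),
      (Y1 * Y2 - a * X1 * X2) * (Z1 * Z2 + d * T1 * T2),
      (X1 * Y2 + X2 * Y1) * (Y1 * Y2 - a * X1 * X2),
      (Z1 * Z2 - d * T1 * T2) * (Z1 * Z2 + d * T1 * T2))"

fun edwards_law2 :: "'a::field \<Rightarrow> 'a \<times> 'a \<times> 'a \<times> 'a \<Rightarrow> 'a \<times> 'a \<times> 'a \<times> 'a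
    \<Rightarrow> 'a \<times> 'a \<times> 'a \<times> 'a" where
  "edwards_law2 a (X1, Y1, T1, Z1) (X2, Y2, T2, Z2) =
     ((T1 * Z2 + T2 * Z1) * (X1 * Y2 - X2 * Y1),
      (T1 * Z2 - T2 * Z1) * (Y1 * Y2 + a * X1 * X2),
      (T1 * Z2 + T2 * Z1) * (T1 * Z2 - T2 * Z1),
      (Y1 * Y2 + a * X1 * X2) * (X1 * Y2 - X2 * Y1))"

definition edwards_add_coords :: "'a::field \<Rightarrow> 'a \<Rightarrow> 'a \<times> 'a \<times> 'a \<times> 'a
    \<Rightarrow> 'a \<times> 'a \<times> 'a \<times> 'a \<Rightarrow> 'a \<times> 'a \<times> 'a \<times> 'a" where
  "edwards_add_coords a d u v =
     (if edwards_law1 a d u v \<noteq> (0, 0, 0, 0) then edwards_law1 a d u v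
      else if edwards_law2 a u v \<noteq> (0, 0, 0, 0) then edwards_law2 a u v
      else (0, 1, 0, 1))"

lift_definition edwards_add :: "'a::field \<Rightarrow> 'a \<Rightarrow> 'a proj3 \<Rightarrow> 'a proj3 \<Rightarrow> 'a proj3"
  is edwards_add_coords
proof -
  fix a d :: 'a and u u' v v' :: "'a \<times> 'a \<times> 'a \<times> 'a"
  assume *: "proj3_rel u u'" "proj3_rel v v'"
  obtain X1 Y1 T1 Z1 where u: "u = (X1, Y1, T1, Z1)" by (cases u) auto
  obtain X1' Y1' T1' Z1' where u': "u' = (X1', Y1', T1', Z1')" by (cases u') auto
  obtain X2 Y2 T2 Z2 where v: "v = (X2, Y2, T2, Z2)" by (cases v) auto
  obtain X2' Y2' T2' Z2' where v': "v' = (X2', Y2', T2', Z2')" by (cases v') auto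
  obtain b where b: "b \<noteq> 0" "X1' = b * X1" "Y1' = b * Y1" "T1' = b * T1" "Z1' = b * Z1"
    using *(1) unfolding u u' by (rule proj3_relE)
  obtain c where c: "c \<noteq> 0" "X2' = c * X2" "Y2' = c * Y2" "T2' = c * T2" "Z2' = c * Z2"
    using *(2) unfolding v v' by (rule proj3_relE)
  define k where "k = (b * c)^2"
  have k: "k \<noteq> 0" using b(1) c(1) by (simp add: k_def)
  define s :: "'a \<times> 'a \<times> 'a \<times> 'a \<Rightarrow> 'a \<times> 'a \<times> 'a \<times> 'a"
    where "s = (\<lambda>(X, Y, T, Z). (k * X, k * Y, k * T, k * Z))"
  have s0: "s p = (0, 0, 0, 0) \<longleftrightarrow> p = (0, 0, 0, 0)" for p
    using k by (cases p) (auto simp: s_def)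
  have rel: "proj3_rel p (s p)" if "p \<noteq> (0, 0, 0, 0)" for p
    using k that by (cases p) (auto simp: s_def intro!: proj3_relI[where c = k])
  have l1: "edwards_law1 a d u' v' = s (edwards_law1 a d u v)"
    by (simp add: u u' v v' b c s_def k_def power2_eq_square algebra_simps)
  have l2: "edwards_law2 a u' v' = s (edwards_law2 a u v)"
    by (simp add: u u' v v' b c s_def k_def power2_eq_square algebra_simps)
  have n: "proj3_rel (0, 1, 0, 1) (0::'a, 1, 0, 1)"
    by (rule proj3_relI[where c = 1]) auto
  show "proj3_rel (edwards_add_coords a d u v) (edwards_add_coords a d u' v')"
    unfolding edwards_add_coords_def l1 l2 s0 using rel n by auto
qed

lemma edwards_laws_complete:
  fixes a d :: "'a::field"
  assumes two: "(2::'a) \<noteq> 0" and ad: "a * d * (a - d) \<noteq> 0"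
    and nz1: "(X1, Y1, T1, Z1) \<noteq> (0, 0, 0, 0)" and nz2: "(X2, Y2, T2, Z2) \<noteq> (0, 0, 0, 0)"
    and c1: "a * X1^2 + Y1^2 = Z1^2 + d * T1^2" "X1 * Y1 = Z1 * T1"
    and c2: "a * X2^2 + Y2^2 = Z2^2 + d * T2^2" "X2 * Y2 = Z2 * T2"
  shows "edwards_law1 a d (X1, Y1, T1, Z1) (X2, Y2, T2, Z2) \<noteq> (0, 0, 0, 0) \<or>
         edwards_law2 a (X1, Y1, T1, Z1) (X2, Y2, T2, Z2) \<noteq> (0, 0, 0, 0)"
proof (rule ccontr)
  assume "\<not> ?thesis"
  then have zero:
    "(X1 * Y2 + X2 * Y1 = 0 \<and> Z1 * Z2 + d * T1 * T2 = 0) \<or>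
     (Y1 * Y2 - a * X1 * X2 = 0 \<and> Z1 * Z2 - d * T1 * T2 = 0)"
    "(T1 * Z2 + T2 * Z1 = 0 \<and> Y1 * Y2 + a * X1 * X2 = 0) \<or>
     (T1 * Z2 - T2 * Z1 = 0 \<and> X1 * Y2 - X2 * Y1 = 0)"
    by auto
  have a: "a \<noteq> 0" and d: "d \<noteq> 0" and neq: "a \<noteq> d" using ad by auto
  have XY: "X \<noteq> 0 \<or> Y \<noteq> 0" and TZ: "T \<noteq> 0 \<or> Z \<noteq> 0"
    if "(X, Y, T, Z) \<noteq> (0, 0, 0, 0)" "a * X^2 + Y^2 = Z^2 + d * T^2" "X * Y = Z * T"
    for X Y T Z :: 'a
    using that a d by (auto simp: power2_eq_square)
  note nz = XY[OF nz1 c1] TZ[OF nz1 c1] XY[OF nz2 c2] TZ[OF nz2 c2]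
  have quad: "q^2 = m * p^2"
    if "q * q' = m * n * p * p'" "p * q' = n * p' * q" "p' \<noteq> 0 \<or> q' \<noteq> 0" "n * n = 1"
    for m n p q p' q' :: 'a
  proof -
    have "q^2 * q' = m * p^2 * q'" "n * (q^2 * p') = n * (m * p^2 * p')"
      using that(1,2,4) by algebra+
    moreover have "n \<noteq> 0" using that(4) by auto
    ultimately show ?thesis using that(3) by auto
  qed
  have no: False if "Y1^2 = a * X1^2" "Z1^2 = d * T1^2"
  proof -
    have "2 * (a * X1^2) = 2 * (d * T1^2)" using c1(1) that by algebra
    then have e: "a * X1^2 = d * T1^2" using two by simp
    have "d * (a - d) * (T1^2 * T1^2) = 0" using that e c1(2) by algebra
    then have "T1 = 0" using d neq by auto
    then show False using that nz by auto
  qed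
  have no': False if "Z^2 = - d * T^2" "T \<noteq> 0 \<or> Z \<noteq> 0" "Z * T = 0" for T Z
    using that d by auto
  have half: "x = 0 \<and> y = 0" if "x + y = 0" "x - y = 0" for x y :: 'a
  proof -
    have "2 * x = 0" using that by algebra
    then show ?thesis using that two by auto
  qed
  from zero show False
  proof (elim disjE conjE)
    assume *: "X1 * Y2 + X2 * Y1 = 0" "Z1 * Z2 + d * T1 * T2 = 0"
      "T1 * Z2 + T2 * Z1 = 0" "Y1 * Y2 + a * X1 * X2 = 0"
    have "Y1^2 = a * X1^2"
      by (rule quad[of _ Y2 _ "-1" _ X2]) (use * nz in algebra | use nz in auto)+
    moreover have "Z1^2 = d * T1^2"
      by (rule quad[of _ Z2 _ "-1" _ T2]) (use * nz in algebra | use nz in auto)+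
    ultimately show False by (rule no)
  next
    assume *: "X1 * Y2 + X2 * Y1 = 0" "Z1 * Z2 + d * T1 * T2 = 0"
      "T1 * Z2 - T2 * Z1 = 0" "X1 * Y2 - X2 * Y1 = 0"
    have z1: "Z1^2 = - d * T1^2"
      by (rule quad[of _ Z2 _ 1 _ T2]) (use * nz in algebra | use nz in auto)+
    have z2: "Z2^2 = - d * T2^2"
      by (rule quad[of _ Z1 _ 1 _ T1]) (use * nz in algebra | use nz in auto)+
    have "X1 * Y2 = 0" "X2 * Y1 = 0" using half[OF *(1,4)] by auto
    then show False
      using no'[OF z1] no'[OF z2] nz c1(2) c2(2) by auto
  next
    assume *: "Y1 * Y2 - a * X1 * X2 = 0" "Z1 * Z2 - d * T1 * T2 = 0"
      "T1 * Z2 + T2 * Z1 = 0" "Y1 * Y2 + a * X1 * X2 = 0"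
    have z1: "Z1^2 = - d * T1^2"
      by (rule quad[of _ Z2 _ "-1" _ T2]) (use * nz in algebra | use nz in auto)+
    have z2: "Z2^2 = - d * T2^2"
      by (rule quad[of _ Z1 _ "-1" _ T1]) (use * nz in algebra | use nz in auto)+
    have "Y1 * Y2 = 0" using half[OF *(4,1)] by auto
    then show False
      using no'[OF z1] no'[OF z2] nz c1(2) c2(2) by auto
  next
    assume *: "Y1 * Y2 - a * X1 * X2 = 0" "Z1 * Z2 - d * T1 * T2 = 0"
      "T1 * Z2 - T2 * Z1 = 0" "X1 * Y2 - X2 * Y1 = 0"
    have "Y1^2 = a * X1^2"
      by (rule quad[of _ Y2 _ 1 _ X2]) (use * nz in algebra | use nz in auto)+
    moreover have "Z1^2 = d * T1^2"
      by (rule quad[of _ Z2 _ 1 _ T2]) (use * nz in algebra | use nz in auto)+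
    ultimately show False by (rule no)
  qed
qed

lemma edwards_add_affine:
  fixes a d :: "'a::field"
  assumes "1 + d * x1 * x2 * y1 * y2 \<noteq> 0" "1 - d * x1 * x2 * y1 * y2 \<noteq> 0"
  shows "edwards_add a d (edwards_affine x1 y1) (edwards_affine x2 y2) =
    edwards_affine ((x1 * y2 + x2 * y1) / (1 + d * x1 * x2 * y1 * y2))
                   ((y1 * y2 - a * x1 * x2) / (1 - d * x1 * x2 * y1 * y2))"
proof (transfer fixing: a d x1 x2 y1 y2)
  define p where "p = 1 + d * x1 * x2 * y1 * y2"
  define m where "m = 1 - d * x1 * x2 * y1 * y2"
  have nz: "p \<noteq> 0" "m \<noteq> 0" using assms by (simp_all add: p_def m_def)
  have eq: "edwards_law1 a d (x1, y1, x1 * y1, 1) (x2, y2, x2 * y2, 1) =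
    ((x1 * y2 + x2 * y1) * m, (y1 * y2 - a * x1 * x2) * p,
     (x1 * y2 + x2 * y1) * (y1 * y2 - a * x1 * x2), m * p)"
    by (simp add: p_def m_def algebra_simps)
  then show "proj3_rel (edwards_add_coords a d (x1, y1, x1 * y1, 1) (x2, y2, x2 * y2, 1))
     ((x1 * y2 + x2 * y1) / (1 + d * x1 * x2 * y1 * y2),
      (y1 * y2 - a * x1 * x2) / (1 - d * x1 * x2 * y1 * y2),
      (x1 * y2 + x2 * y1) / (1 + d * x1 * x2 * y1 * y2) *
        ((y1 * y2 - a * x1 * x2) / (1 - d * x1 * x2 * y1 * y2)), 1)"
    unfolding edwards_add_coords_def eq p_def[symmetric] m_def[symmetric]
    using nz by (auto intro!: proj3_relI[where c = "inverse (m * p)"] simp: field_simps)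
qed

section \<open>The function \<open>w\<close> and quotients in the projective line\<close>

datatype 'a ext = Fin 'a | Infty

lift_definition edwards_w :: "'a::field \<Rightarrow> 'a proj3 \<Rightarrow> 'a ext"
  is "\<lambda>d (X, Y, T, Z). if Z = 0 then Infty else Fin (d * (X / Z)^2 * (Y / Z)^2)"
proof -
  fix d :: 'a and u v :: "'a \<times> 'a \<times> 'a \<times> 'a"
  assume *: "proj3_rel u v"
  obtain X Y T Z where u: "u = (X, Y, T, Z)" by (cases u) auto
  obtain X' Y' T' Z' where v: "v = (X', Y', T', Z')" by (cases v) auto
  obtain c where c: "c \<noteq> 0" "X' = c * X" "Y' = c * Y" "T' = c * T" "Z' = c * Z"
    using * unfolding u v by (rule proj3_relE)
  then show "(case u of (X, Y, T, Z) \<Rightarrow> if Z = 0 then Infty else Fin (d * (X / Z)^2 * (Y / Z)^2)) =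
    (case v of (X, Y, T, Z) \<Rightarrow> if Z = 0 then Infty else Fin (d * (X / Z)^2 * (Y / Z)^2))"
    by (simp add: u v)
qed

text \<open>\<open>None\<close> stands for the undefined quotient of \<open>0\<close> by \<open>0\<close>.\<close>

definition ext_quot :: "'a::field \<Rightarrow> 'a \<Rightarrow> 'a ext option" where
  "ext_quot W Z = (if Z \<noteq> 0 then Some (Fin (W / Z)) else if W \<noteq> 0 then Some Infty else None)"

definition quad_char :: "'a::field \<Rightarrow> int" where
  "quad_char x = (if x = 0 then 0 else if \<exists>y. x = y^2 then 1 else -1)"

section \<open>Straight-line programs and their cost\<close>

text \<open>
  Registers and curve constants are named by strings; reading an unassigned register yields
  \<open>None\<close>. Since \<open>ConstMul\<close> takes its factor from a separate environment, only
  the constants supplied there can be multiplied by at the cost of a constant multiplication.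
\<close>

datatype instr =
    Add string string
  | Sub string string
  | Dbl string
  | Copy string
  | Mul string string
  | Sqr string
  | ConstMul string string

type_synonym slp = "(string \<times> instr) list"

fun eval_instr :: "(string \<rightharpoonup> 'a::field) \<Rightarrow> (string \<rightharpoonup> 'a) \<Rightarrow> instr \<Rightarrow> 'a option" where
  "eval_instr \<kappa> \<sigma> (Add x y) = Option.bind (\<sigma> x) (\<lambda>u. map_option (\<lambda>v. u + v) (\<sigma> y))"
| "eval_instr \<kappa> \<sigma> (Sub x y) = Option.bind (\<sigma> x) (\<lambda>u. map_option (\<lambda>v. u - v) (\<sigma> y))"
| "eval_instr \<kappa> \<sigma> (Dbl x) = map_option (\<lambda>u. 2 * u) (\<sigma> x)"
| "eval_instr \<kappa> \<sigma> (Copy x) = \<sigma> x"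
| "eval_instr \<kappa> \<sigma> (Mul x y) = Option.bind (\<sigma> x) (\<lambda>u. map_option (\<lambda>v. u * v) (\<sigma> y))"
| "eval_instr \<kappa> \<sigma> (Sqr x) = map_option (\<lambda>u. u^2) (\<sigma> x)"
| "eval_instr \<kappa> \<sigma> (ConstMul k x) = Option.bind (\<kappa> k) (\<lambda>u. map_option (\<lambda>v. u * v) (\<sigma> x))"

fun run_slp :: "(string \<rightharpoonup> 'a::field) \<Rightarrow> slp \<Rightarrow> (string \<rightharpoonup> 'a) \<Rightarrow> (string \<rightharpoonup> 'a)" where
  "run_slp \<kappa> [] \<sigma> = \<sigma>"
| "run_slp \<kappa> ((x, i) # p) \<sigma> = run_slp \<kappa> p (\<sigma>(x := eval_instr \<kappa> \<sigma> i))"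

text \<open>The arguments are the costs of a multiplication, a squaring and a multiplication by a
  curve constant.\<close>

fun instr_cost :: "real \<Rightarrow> real \<Rightarrow> real \<Rightarrow> instr \<Rightarrow> real" where
  "instr_cost cM cS cD (Mul x y) = cM"
| "instr_cost cM cS cD (Sqr x) = cS"
| "instr_cost cM cS cD (ConstMul k x) = cD"
| "instr_cost cM cS cD (Add x y) = 0"
| "instr_cost cM cS cD (Sub x y) = 0"
| "instr_cost cM cS cD (Dbl x) = 0"
| "instr_cost cM cS cD (Copy x) = 0"

definition slp_cost :: "real \<Rightarrow> real \<Rightarrow> real \<Rightarrow> slp \<Rightarrow> real" where
  "slp_cost cM cS cD p = (\<Sum>(x, i)\<leftarrow>p. instr_cost cM cS cD i)"

definition ladder_inputs :: "'a \<Rightarrow> 'a \<Rightarrow> 'a \<Rightarrow> 'a \<Rightarrow> 'a \<Rightarrow> (string \<rightharpoonup> 'a)" where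
  "ladder_inputs w0 W1 Z1 W2 Z2 =
     [''w0'' \<mapsto> w0, ''W1'' \<mapsto> W1, ''Z1'' \<mapsto> Z1, ''W2'' \<mapsto> W2, ''Z2'' \<mapsto> Z2]"

definition computes_ladder_step ::
    "slp \<Rightarrow> (string \<rightharpoonup> 'a::field) \<Rightarrow> (string \<rightharpoonup> 'a) \<Rightarrow> 'a \<times> 'a \<Rightarrow> 'a \<times> 'a \<Rightarrow> bool" where
  "computes_ladder_step p \<kappa> \<sigma> v3 v4 \<longleftrightarrow>
     run_slp \<kappa> p \<sigma> ''W3'' = Some (fst v3) \<and> run_slp \<kappa> p \<sigma> ''Z3'' = Some (snd v3) \<and>
     run_slp \<kappa> p \<sigma> ''W4'' = Some (fst v4) \<and> run_slp \<kappa> p \<sigma> ''Z4'' = Some (snd v4)"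

definition diff_add_slp :: slp where
  "diff_add_slp =
    [(''A1'', Add ''W1'' ''Z1''),
     (''B1'', Sub ''W1'' ''Z1''),
     (''A2'', Add ''W2'' ''Z2''),
     (''B2'', Sub ''W2'' ''Z2''),
     (''C'', Mul ''A1'' ''B2''),
     (''D'', Mul ''A2'' ''B1''),
     (''C-D'', Sub ''C'' ''D''),
     (''C+D'', Add ''C'' ''D''),
     (''W3'', Sqr ''C-D''),
     (''(C+D)^2'', Sqr ''C+D''),
     (''Z3'', Mul ''w0'' ''(C+D)^2'')]"

definition ladder_slp_i :: slp where
  "ladder_slp_i = diff_add_slp @
    [(''A1^2'', Sqr ''A1''),
     (''B1^2'', Sqr ''B1''),
     (''E'', Sub ''A1^2'' ''B1^2''),
     (''e/4 E'', ConstMul ''e/4'' ''E''),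
     (''A1^2 - e/4 E'', Sub ''A1^2'' ''e/4 E''),
     (''W4'', Mul ''E'' ''A1^2 - e/4 E''),
     (''Z4'', Mul ''A1^2'' ''B1^2'')]"

definition ladder_slp_ii :: slp where
  "ladder_slp_ii = diff_add_slp @
    [(''A1^2'', Sqr ''A1''),
     (''B1^2'', Sqr ''B1''),
     (''E'', Sub ''A1^2'' ''B1^2''),
     (''A1^4'', Sqr ''A1^2''),
     (''B1^4'', Sqr ''B1^2''),
     (''E^2'', Sqr ''E''),
     (''A1^4 + B1^4'', Add ''A1^4'' ''B1^4''),
     (''F'', Sub ''A1^4 + B1^4'' ''E^2''),
     (''e/4 E^2'', ConstMul ''e/4'' ''E^2''),
     (''A1^4 - e/4 E^2'', Sub ''A1^4'' ''e/4 E^2''),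
     (''2 (A1^4 - e/4 E^2)'', Dbl ''A1^4 - e/4 E^2''),
     (''W4'', Sub ''2 (A1^4 - e/4 E^2)'' ''F''),
     (''Z4'', Copy ''F'')]"

definition ladder_slp_iii :: slp where
  "ladder_slp_iii = diff_add_slp @
    [(''A1^2'', Sqr ''A1''),
     (''B1^2'', Sqr ''B1''),
     (''r A1^2'', ConstMul ''r'' ''A1^2''),
     (''r A1^2 + B1^2'', Add ''r A1^2'' ''B1^2''),
     (''r A1^2 - B1^2'', Sub ''r A1^2'' ''B1^2''),
     (''H1'', Sqr ''r A1^2 + B1^2''),
     (''H2'', Sqr ''r A1^2 - B1^2''),
     (''G'', Add ''H1'' ''H2''),
     (''K'', Sub ''H1'' ''H2''),
     (''S'', ConstMul ''1/r'' ''K''),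
     (''T'', ConstMul ''r'' ''K''),
     (''2G'', Dbl ''G''),
     (''2G - S'', Sub ''2G'' ''S''),
     (''W4'', Sub ''2G - S'' ''T''),
     (''Z4'', Sub ''T'' ''S'')]"

end

theory Submission
  imports Defs
begin

text \<open>
  On the curve, \<open>w(X : Y : T : Z)\<close> is the point \<open>d T\<^sup>2 : Z\<^sup>2\<close> of the projective line, also at infinity.
  For two points put \<open>U = (X1 Y2 + X2 Y1) (Y1 Y2 - a X1 X2)\<close>,
  \<open>V = (X1 Y2 - X2 Y1) (Y1 Y2 + a X1 X2)\<close>,
  \<open>N = Z1\<^sup>2 Z2\<^sup>2 - d\<^sup>2 T1\<^sup>2 T2\<^sup>2\<close> and \<open>M = T1\<^sup>2 Z2\<^sup>2 - T2\<^sup>2 Z1\<^sup>2\<close>. The two addition laws give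
  \<open>T : Z = U : N = M : V\<close> for the sum and \<open>-V : N = -M : U\<close> for the difference, and the curve
  equations imply \<open>U V = N M\<close>. Hence \<open>w(P1 + P2) w(P2 - P1) = d\<^sup>2 M\<^sup>2 / N\<^sup>2\<close>, which is the
  differential addition formula up to scaling; \<open>N = 0\<close> happens exactly when the sum is at
  infinity, the difference having a finite nonzero \<open>w\<close>.
  Doubling uses \<open>(Y\<^sup>2 - a X\<^sup>2)\<^sup>2 = (Z\<^sup>2 + d T\<^sup>2)\<^sup>2 - 4 a Z\<^sup>2 T\<^sup>2\<close>; the three
  variants of the doubling formula differ by the nonzero factors \<open>2\<close> and \<open>-16/e\<close>.
\<close>

section \<open>Odd characteristic and quotients in the projective line\<close>

lemma two_neq_zero_of_odd_CHAR:
  assumes "odd CHAR('a::field)"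
  shows "(2::'a) \<noteq> 0"
proof
  assume "(2::'a) = 0"
  then have "of_nat 2 = (0::'a)" by simp
  then have "CHAR('a) dvd 2" by (simp only: of_nat_eq_0_iff_char_dvd)
  then have "CHAR('a) \<le> 2" by (rule dvd_imp_le) simp
  moreover have "CHAR('a) \<noteq> 2" using assms by auto
  moreover have "CHAR('a) \<noteq> 0" using assms by (metis even_zero)
  moreover have "CHAR('a) \<noteq> 1" by simp
  ultimately show False by linarith
qed

lemma four_neq_zero:
  assumes "(2::'a::field) \<noteq> 0"
  shows "(4::'a) \<noteq> 0"
proof -
  have "(4::'a) = 2 * 2" by simp
  then show ?thesis using assms by (metis mult_eq_0_iff)
qed

lemma ext_quot_scale: "k \<noteq> 0 \<Longrightarrow> ext_quot (k * W) (k * Z) = ext_quot W Z"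
  by (simp add: ext_quot_def)

text \<open>Serves to replace an arbitrary input pair representing \<open>w(P)\<close> by a nonzero
  multiple of the pair \<open>(d * T^2, Z^2)\<close> read off from coordinates of
  \<open>P\<close>.\<close>

lemma ext_quot_eqD:
  assumes "(W, Z) \<noteq> (0, 0)" "ext_quot W Z = ext_quot W' Z'"
  obtains k where "k \<noteq> 0" "W = k * W'" "Z = k * Z'"
proof (cases "Z = 0")
  case True
  then have "W \<noteq> 0" "Z' = 0" "W' \<noteq> 0" using assms by (auto simp: ext_quot_def split: if_splits)
  then show ?thesis using True by (intro that[of "W / W'"]) auto
next
  case False
  then have "Z' \<noteq> 0" "W / Z = W' / Z'" using assms by (auto simp: ext_quot_def split: if_splits)
  then show ?thesis using False by (intro that[of "Z / Z'"]) (auto simp: field_simps)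
qed

section \<open>Points of the curve and the function \<open>w\<close> in coordinates\<close>

lemma proj3_rel_refl: "proj3_rel v v \<longleftrightarrow> v \<noteq> (0, 0, 0, 0)"
  by (cases v) (auto simp: proj3_rel_def intro: exI[of _ 1])

lemma edwards_curve_cases:
  assumes "P \<in> edwards_curve a d"
  obtains X Y T Z where "P = abs_proj3 (X, Y, T, Z)" "(X, Y, T, Z) \<noteq> (0, 0, 0, 0)"
    "a * X^2 + Y^2 = Z^2 + d * T^2" "X * Y = Z * T"
proof -
  have "\<exists>v. proj3_rel v v \<and> P = abs_proj3 v"
    using Quotient_proj3 by (metis Quotient_abs_rep Quotient_rep_reflp)
  then obtain X Y T Z where v: "proj3_rel (X, Y, T, Z) (X, Y, T, Z)" "P = abs_proj3 (X, Y, T, Z)"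
    by (metis prod_cases4)
  then show ?thesis
    using assms that by (simp add: edwards_curve_def on_edwards.abs_eq proj3_rel_refl)
qed

text \<open>The relation \<open>X * Y = Z * T\<close> turns \<open>d * (X * Y)^2 / Z^4\<close> into
  \<open>d * T^2 / Z^2\<close>. The output of either addition law satisfies this relation by its
  product shape, so \<open>w\<close> of a sum can be read off without first checking that the sum
  lies on the curve.\<close>

lemma edwards_w_abs:
  fixes d :: "'a::field"
  assumes "(X, Y, T, Z) \<noteq> (0, 0, 0, 0)" "X * Y = Z * T"
  shows "edwards_w d (abs_proj3 (X, Y, T, Z)) = (if Z = 0 then Infty else Fin (d * T^2 / Z^2))"
proof -
  have "d * (X / Z)^2 * (Y / Z)^2 = d * T^2 / Z^2" if "Z \<noteq> 0"
  proof -
    have "d * (X / Z)^2 * (Y / Z)^2 = d * (X * Y)^2 / Z^4"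
      by (simp add: power_divide power_mult_distrib flip: power_add)
    then show ?thesis using that unfolding assms(2)
      by (simp add: power_mult_distrib field_simps power2_eq_square power4_eq_xxxx)
  qed
  then show ?thesis using assms(1) by (simp add: edwards_w.abs_eq proj3_rel_refl)
qed

lemma edwards_w_abs_ext_quot:
  fixes d :: "'a::field"
  assumes "(X, Y, T, Z) \<noteq> (0, 0, 0, 0)" "X * Y = Z * T" "d \<noteq> 0" "(T, Z) \<noteq> (0, 0)"
  shows "Some (edwards_w d (abs_proj3 (X, Y, T, Z))) = ext_quot (d * T^2) (Z^2)"
  using assms by (auto simp: edwards_w_abs ext_quot_def)

text \<open>If \<open>T = Z = 0\<close>, then one of \<open>X\<close>, \<open>Y\<close> vanishes,
  and \<open>a * X^2 + Y^2 = 0\<close> with \<open>a\<close> nonzero kills the other.\<close>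

lemma edwards_TZ_nonzero:
  fixes a d :: "'a::field"
  assumes "a * d * (a - d) \<noteq> 0" "(X, Y, T, Z) \<noteq> (0, 0, 0, 0)"
    "a * X^2 + Y^2 = Z^2 + d * T^2" "X * Y = Z * T"
  shows "(T, Z) \<noteq> (0, 0)"
  using assms by (auto simp: power2_eq_square)

lemma edwards_add_abs:
  assumes "u \<noteq> (0, 0, 0, 0)" "v \<noteq> (0, 0, 0, 0)"
  shows "edwards_add a d (abs_proj3 u) (abs_proj3 v) = abs_proj3 (edwards_add_coords a d u v)"
  using assms by (simp add: edwards_add.abs_eq proj3_rel_refl)

lemma edwards_neg_abs:
  assumes "(X, Y, T, Z) \<noteq> (0, 0, 0, 0)"
  shows "edwards_neg (abs_proj3 (X, Y, T, Z)) = abs_proj3 (- X, Y, - T, Z)"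
  using assms by (simp add: edwards_neg.abs_eq proj3_rel_refl)

section \<open>Doubling\<close>

text \<open>The free factor \<open>k\<close> lets one computation cover all three variants: they are
  the cases \<open>k = 1\<close>, \<open>k = 2\<close> and \<open>k = -16/e\<close>.\<close>

lemma edwards_w_double:
  fixes a d :: "'a::field"
  assumes two: "(2::'a) \<noteq> 0" and ad: "a * d * (a - d) \<noteq> 0" and P: "P \<in> edwards_curve a d"
    and WZ: "(W, Z) \<noteq> (0, 0)" "Some (edwards_w d P) = ext_quot W Z"
    and e: "e = 4 * a / d" and A: "A = W + Z" and B: "B = W - Z"
    and E: "E = A^2 - B^2"
    and k: "k \<noteq> 0" "W4 = k * (E * (A^2 - (e/4) * E))" "Z4 = k * (A^2 * B^2)"
  shows "(W4, Z4) \<noteq> (0, 0) \<and> Some (edwards_w d (edwards_add a d P P)) = ext_quot W4 Z4"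
proof -
  have d: "d \<noteq> 0" and a: "a \<noteq> 0" and a_d: "a \<noteq> d" using ad by auto
  obtain x y t z where P': "P = abs_proj3 (x, y, t, z)" and nz: "(x, y, t, z) \<noteq> (0, 0, 0, 0)"
    and c: "a * x^2 + y^2 = z^2 + d * t^2" "x * y = z * t"
    using P by (rule edwards_curve_cases)
  note tz = edwards_TZ_nonzero[OF ad nz c]
  obtain l where l: "l \<noteq> 0" "W = l * (d * t^2)" "Z = l * z^2"
    using WZ edwards_w_abs_ext_quot[OF nz c(2) d tz] unfolding P' by (metis ext_quot_eqD)
  define T3 where "T3 = 2 * (x * y) * (y^2 - a * x^2)"
  define Z3 where "Z3 = (z^2 - d * t^2) * (z^2 + d * t^2)"
  define X3 where "X3 = 2 * (x * y) * (z^2 - d * t^2)"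
  define Y3 where "Y3 = (y^2 - a * x^2) * (z^2 + d * t^2)"
  have law: "edwards_law1 a d (x, y, t, z) (x, y, t, z) = (X3, Y3, T3, Z3)"
    by (simp add: X3_def Y3_def T3_def Z3_def power2_eq_square algebra_simps)
  \<comment> \<open>The first addition law never degenerates on a doubling, so the dual law does not
    enter here.\<close>
  have nz3: "(T3, Z3) \<noteq> (0, 0)"
  proof
    assume "(T3, Z3) = (0, 0)"
    then have T: "x = 0 \<or> y = 0 \<or> y^2 = a * x^2" and Z: "z^2 = d * t^2 \<or> z^2 = - (d * t^2)"
      using two by (auto simp: T3_def Z3_def eq_neg_iff_add_eq_0)
    from Z have "z \<noteq> 0" "t \<noteq> 0" using tz d by auto
    then have xy: "x \<noteq> 0" "y \<noteq> 0" using c(2) by auto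
    with T have T: "y^2 = a * x^2" by blast
    from Z show False
    proof
      assume z: "z^2 = d * t^2"
      have "2 * (a * x^2) = 2 * (d * t^2)" using c(1) T z by algebra
      then have 1: "a * x^2 = d * t^2" using two by simp
      \<comment> \<open>Squaring \<open>x * y = z * t\<close> gives
        \<open>a * x^4 = d * t^4\<close>, while squaring fact \<open>1\<close> gives
        \<open>a^2 * x^4 = d^2 * t^4\<close>.\<close>
      have "d * (a - d) * (t^2 * t^2) = 0" using 1 T z c(2) by algebra
      then show False using d a_d \<open>t \<noteq> 0\<close> by auto
    next
      assume z: "z^2 = - (d * t^2)"
      have "2 * y^2 = 0" using c(1) T z by algebra
      then show False using two xy by auto
    qed
  qed
  then have add: "edwards_add a d P P = abs_proj3 (X3, Y3, T3, Z3)"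
    unfolding P' edwards_add_abs[OF nz nz] edwards_add_coords_def law by auto
  have XY: "X3 * Y3 = Z3 * T3" by (simp add: X3_def Y3_def T3_def Z3_def)
  have w: "Some (edwards_w d (edwards_add a d P P)) = ext_quot (d * T3^2) (Z3^2)"
    unfolding add using nz3 XY d by (intro edwards_w_abs_ext_quot) auto
  \<comment> \<open>\<open>E\<close> is \<open>4 * W * Z\<close>; its factor \<open>d\<close>
    cancels the denominator of \<open>e / 4 = a / d\<close> below.\<close>
  have E': "E = 4 * l^2 * d * t^2 * z^2"
    unfolding E A B l by algebra
  define f where "f = e / 4"
  have fE: "f * E = 4 * l^2 * a * t^2 * z^2"
  proof -
    have "4 * (a / d) / 4 = a / d" by (rule nonzero_mult_div_cancel_left) (rule four_neq_zero[OF two])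
    then have "f = a / d" by (simp only: f_def e times_divide_eq_right)
    then have "f * E = a / d * d * (4 * l^2 * t^2 * z^2)"
      by (simp only: E' ac_simps)
    also have "a / d * d = a" using d by simp
    finally show ?thesis by (simp only: ac_simps)
  qed
  \<comment> \<open>The difference of squares \<open>(y^2 - a * x^2)^2 - (y^2 + a * x^2)^2\<close>
    is \<open>-4 * a * (x * y)^2\<close>; then both curve equations are inserted.\<close>
  have sq: "(y^2 - a * x^2)^2 = (z^2 + d * t^2)^2 - 4 * a * z^2 * t^2"
    using c by algebra
  have T3: "T3^2 = 4 * (z * t)^2 * ((z^2 + d * t^2)^2 - 4 * a * z^2 * t^2)"
    unfolding T3_def c(2) sq[symmetric] by algebra
  have "A = l * (z^2 + d * t^2)" unfolding A l by algebra
  then have "E * (A^2 - f * E) = l^4 * (d * T3^2)"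
    unfolding fE T3 unfolding E' by algebra
  moreover have "A^2 * B^2 = l^4 * Z3^2"
    unfolding A B l Z3_def by algebra
  ultimately have WZ4: "W4 = (k * l^4) * (d * T3^2)" "Z4 = (k * l^4) * Z3^2"
    using k by (simp_all only: f_def mult.assoc)
  have kl: "k * l^4 \<noteq> 0" using k l by simp
  show ?thesis
    unfolding w unfolding WZ4 ext_quot_scale[OF kl] using kl nz3 d by auto
qed

section \<open>Differential addition\<close>

lemma edwards_w_diff_add:
  fixes a d :: "'a::field"
  assumes two: "(2::'a) \<noteq> 0" and ad: "a * d * (a - d) \<noteq> 0"
    and P1: "P1 \<in> edwards_curve a d" and P2: "P2 \<in> edwards_curve a d"
    and w0: "edwards_w d (edwards_add a d P2 (edwards_neg P1)) = Fin w0" "w0 \<noteq> 0"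
    and WZ1: "(W1, Z1) \<noteq> (0, 0)" "Some (edwards_w d P1) = ext_quot W1 Z1"
    and WZ2: "(W2, Z2) \<noteq> (0, 0)" "Some (edwards_w d P2) = ext_quot W2 Z2"
    and C: "C = (W1 + Z1) * (W2 - Z2)" and D: "D = (W2 + Z2) * (W1 - Z1)"
    and W3: "W3 = (C - D)^2" and Z3: "Z3 = w0 * (C + D)^2"
  shows "(W3, Z3) \<noteq> (0, 0) \<and> Some (edwards_w d (edwards_add a d P1 P2)) = ext_quot W3 Z3"
proof -
  have d: "d \<noteq> 0" using ad by auto
  obtain x1 y1 t1 z1 where P1': "P1 = abs_proj3 (x1, y1, t1, z1)"
    and nz1: "(x1, y1, t1, z1) \<noteq> (0, 0, 0, 0)"
    and c1: "a * x1^2 + y1^2 = z1^2 + d * t1^2" "x1 * y1 = z1 * t1"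
    using P1 by (rule edwards_curve_cases)
  obtain x2 y2 t2 z2 where P2': "P2 = abs_proj3 (x2, y2, t2, z2)"
    and nz2: "(x2, y2, t2, z2) \<noteq> (0, 0, 0, 0)"
    and c2: "a * x2^2 + y2^2 = z2^2 + d * t2^2" "x2 * y2 = z2 * t2"
    using P2 by (rule edwards_curve_cases)
  obtain k where k: "k \<noteq> 0" "W1 = k * (d * t1^2)" "Z1 = k * z1^2"
    using WZ1 edwards_w_abs_ext_quot[OF nz1 c1(2) d edwards_TZ_nonzero[OF ad nz1 c1]]
    unfolding P1' by (metis ext_quot_eqD)
  obtain l where l: "l \<noteq> 0" "W2 = l * (d * t2^2)" "Z2 = l * z2^2"
    using WZ2 edwards_w_abs_ext_quot[OF nz2 c2(2) d edwards_TZ_nonzero[OF ad nz2 c2]]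
    unfolding P2' by (metis ext_quot_eqD)
  \<comment> \<open>The quantities of the overview factor as \<open>U = p * q\<close>,
    \<open>V = p' * q'\<close>, \<open>N = m * n\<close> and \<open>M = r * s\<close>.\<close>
  define p where "p = x1 * y2 + x2 * y1"
  define q where "q = y1 * y2 - a * x1 * x2"
  define p' where "p' = x1 * y2 - x2 * y1"
  define q' where "q' = y1 * y2 + a * x1 * x2"
  define m where "m = z1 * z2 - d * t1 * t2"
  define n where "n = z1 * z2 + d * t1 * t2"
  define r where "r = t1 * z2 + t2 * z1"
  define s where "s = t1 * z2 - t2 * z1"
  have nz1': "(- x1, y1, - t1, z1) \<noteq> (0, 0, 0, 0)" using nz1 by auto
  have sum1: "edwards_law1 a d (x1, y1, t1, z1) (x2, y2, t2, z2) = (p * m, q * n, p * q, m * n)"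
    by (simp add: p_def q_def m_def n_def)
  \<comment> \<open>Negating \<open>P1\<close> exchanges \<open>p\<close> with \<open>-p'\<close>,
    \<open>q\<close> with \<open>q'\<close>, \<open>m\<close> with \<open>n\<close>, and
    \<open>r\<close> with \<open>-s\<close>.\<close>
  have diff1: "edwards_law1 a d (x2, y2, t2, z2) (- x1, y1, - t1, z1) =
      (- p' * n, q' * m, - p' * q', n * m)"
    by (simp add: p'_def q'_def m_def n_def algebra_simps)
  have diff2: "edwards_law2 a (x2, y2, t2, z2) (- x1, y1, - t1, z1) =
      (- s * p, r * q, - s * r, q * p)"
    by (simp add: p_def q_def r_def s_def algebra_simps)
  have sum: "edwards_add a d P1 P2 =
      abs_proj3 (edwards_add_coords a d (x1, y1, t1, z1) (x2, y2, t2, z2))"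
    unfolding P1' P2' by (rule edwards_add_abs[OF nz1 nz2])
  have diff: "edwards_add a d P2 (edwards_neg P1) =
      abs_proj3 (edwards_add_coords a d (x2, y2, t2, z2) (- x1, y1, - t1, z1))"
    unfolding P1' P2' edwards_neg_abs[OF nz1] by (rule edwards_add_abs[OF nz2 nz1'])
  have key: "(p * q) * (p' * q') = (m * n) * (r * s)"
  proof -
    \<comment> \<open>The product is regrouped through
      \<open>y^4 + a^2 * x^4 = (a * x^2 + y^2)^2 - 2 * a * (x * y)^2\<close>, so that only the
      expressions in the curve equations occur. After substitution the terms with \<open>a\<close>
      cancel.\<close>
    have "(p * q) * (p' * q') = (x1 * y1)^2 * ((a * x2^2 + y2^2)^2 - 2 * a * (x2 * y2)^2)
        - (x2 * y2)^2 * ((a * x1^2 + y1^2)^2 - 2 * a * (x1 * y1)^2)"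
      unfolding p_def q_def p'_def q'_def by algebra
    also have "\<dots> = (m * n) * (r * s)"
      unfolding c1 c2 m_def n_def r_def s_def by algebra
    finally show ?thesis .
  qed
  \<comment> \<open>Here \<open>C - D = 2 * (Z1 * W2 - W1 * Z2)\<close> and
    \<open>C + D = 2 * (W1 * W2 - Z1 * Z2)\<close>, which are \<open>-2 * k * l\<close> times
    \<open>d * M\<close> and \<open>N\<close>.\<close>
  have W3': "W3 = (4 * k^2 * l^2) * (d * (r * s))^2"
    unfolding W3 C D k l r_def s_def by algebra
  have Z3': "Z3 = (4 * k^2 * l^2) * (w0 * (m * n)^2)"
    unfolding Z3 C D k l m_def n_def by algebra
  have kl: "4 * k^2 * l^2 \<noteq> 0" using k l four_neq_zero[OF two] by simp
  have goal: ?thesis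
    if "(r * s, m * n) \<noteq> (0, 0)"
      "Some (edwards_w d (edwards_add a d P1 P2)) = ext_quot ((d * (r * s))^2) (w0 * (m * n)^2)"
    unfolding that(2) unfolding W3' Z3' ext_quot_scale[OF kl] using that(1) kl d w0(2) by auto
  show ?thesis
  proof (cases "m * n = 0")
    case False
    then have s1: "edwards_add a d P1 P2 = abs_proj3 (p * m, q * n, p * q, m * n)"
      unfolding sum edwards_add_coords_def sum1 by auto
    have "edwards_add a d P2 (edwards_neg P1) = abs_proj3 (- p' * n, q' * m, - p' * q', n * m)"
      unfolding diff edwards_add_coords_def diff1 using False by auto
    moreover have "edwards_w d \<dots> = Fin (d * (- p' * q')^2 / (n * m)^2)"
      using False by (subst edwards_w_abs) auto
    ultimately have w0': "w0 = d * (p' * q')^2 / (m * n)^2"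
      using w0(1) by (simp add: mult.commute)
    have "edwards_w d (edwards_add a d P1 P2) = Fin (d * (p * q)^2 / (m * n)^2)"
      unfolding s1 using False by (subst edwards_w_abs) auto
    moreover have "d * (p * q)^2 / (m * n)^2 = (d * (r * s))^2 / (w0 * (m * n)^2)"
    proof -
      have "w0 * (m * n)^2 = d * (p' * q')^2" using w0' False by simp
      moreover have "p' * q' \<noteq> 0" using w0(2) w0' by auto
      moreover have "(d * (p * q)^2) * (d * (p' * q')^2) = (d * (r * s))^2 * (m * n)^2"
        using key by algebra
      ultimately show ?thesis
        using False d by (intro iffD2[OF frac_eq_eq]) simp_all
    qed
    ultimately show ?thesis
      using False w0(2) by (intro goal) (auto simp: ext_quot_def)
  next
    case True
    \<comment> \<open>A nonzero output of the first law would have last coordinate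
      \<open>N = 0\<close>, putting the difference at infinity against the finiteness of
      \<open>w0\<close>.\<close>
    have "edwards_law1 a d (x2, y2, t2, z2) (- x1, y1, - t1, z1) = (0, 0, 0, 0)"
    proof (rule ccontr)
      assume nz: "\<not> ?thesis"
      then have "edwards_add a d P2 (edwards_neg P1) = abs_proj3 (- p' * n, q' * m, - p' * q', n * m)"
        unfolding diff edwards_add_coords_def diff1 by simp
      moreover have "edwards_w d \<dots> = Infty"
        using nz True unfolding diff1 by (subst edwards_w_abs) auto
      ultimately show False using w0(1) by simp
    qed
    \<comment> \<open>The default value \<open>(0, 1, 0, 1)\<close> of the addition has
      \<open>w = 0\<close>, so \<open>w0\<close> being nonzero excludes it.\<close>
    moreover have "edwards_law2 a (x2, y2, t2, z2) (- x1, y1, - t1, z1) \<noteq> (0, 0, 0, 0)"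
    proof
      assume "edwards_law2 a (x2, y2, t2, z2) (- x1, y1, - t1, z1) = (0, 0, 0, 0)"
      with calculation have "edwards_add a d P2 (edwards_neg P1) = abs_proj3 (0, 1, 0, 1)"
        unfolding diff edwards_add_coords_def by simp
      moreover have "edwards_w d \<dots> = Fin 0"
        by (subst edwards_w_abs) auto
      ultimately show False using w0 by simp
    qed
    ultimately have
      add: "edwards_add a d P2 (edwards_neg P1) = abs_proj3 (- s * p, r * q, - s * r, q * p)"
      and nz: "(- s * p, r * q, - s * r, q * p) \<noteq> (0, 0, 0, 0)"
      unfolding diff edwards_add_coords_def diff2 by auto
    note add
    moreover have "edwards_w d (abs_proj3 (- s * p, r * q, - s * r, q * p)) =
        (if q * p = 0 then Infty else Fin (d * (- s * r)^2 / (q * p)^2))"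
      using nz by (intro edwards_w_abs) auto
    \<comment> \<open>Now \<open>w0 = d * M^2 / U^2\<close> is finite and nonzero, so neither
      \<open>U\<close> nor \<open>M\<close> vanishes. Hence the first law is nonzero on the sum, and
      \<open>N = 0\<close> places the sum at infinity.\<close>
    ultimately have "p * q \<noteq> 0" "r * s \<noteq> 0" using w0 by (auto split: if_splits)
    then have "edwards_add a d P1 P2 = abs_proj3 (p * m, q * n, p * q, m * n)"
      unfolding sum edwards_add_coords_def sum1 by auto
    moreover have "edwards_w d \<dots> = Infty"
      using True \<open>p * q \<noteq> 0\<close> by (subst edwards_w_abs) auto
    ultimately show ?thesis
      using True \<open>r * s \<noteq> 0\<close> d by (intro goal) (auto simp: ext_quot_def)
  qed
qed

section \<open>The square criterion, the three doubling variants and the costs\<close>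

theorem mainTheorem1:
  fixes a d e w0 W1 Z1 W2 Z2 A1 B1 A2 B2 C D W3 Z3 :: "'a::{field,finite}"
    and P1 P2 :: "'a proj3"
    and cM cS cD :: real
  assumes "odd CHAR('a)"
    and "a * d * (a - d) \<noteq> 0"
    and "e = 4 * a / d"
    and "P1 \<in> edwards_curve a d" and "P2 \<in> edwards_curve a d"
    and "edwards_w d (edwards_add a d P2 (edwards_neg P1)) = Fin w0" and "w0 \<noteq> 0"
    and "(W1, Z1) \<noteq> (0, 0)" and "Some (edwards_w d P1) = ext_quot W1 Z1"
    and "(W2, Z2) \<noteq> (0, 0)" and "Some (edwards_w d P2) = ext_quot W2 Z2"
    and "A1 = W1 + Z1" and "B1 = W1 - Z1" and "A2 = W2 + Z2" and "B2 = W2 - Z2"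
    and "C = A1 * B2" and "D = A2 * B1"
    and "W3 = (C - D)^2" and "Z3 = w0 * (C + D)^2"
  shows
    "((W3, Z3) \<noteq> (0, 0) \<and> Some (edwards_w d (edwards_add a d P1 P2)) = ext_quot W3 Z3) \<and>
     (let E = A1^2 - B1^2; W4 = E * (A1^2 - (e/4) * E); Z4 = A1^2 * B1^2
      in (W4, Z4) \<noteq> (0, 0) \<and> Some (edwards_w d (edwards_add a d P1 P1)) = ext_quot W4 Z4 \<and>
         computes_ladder_step ladder_slp_i [''e/4'' \<mapsto> e/4]
           (ladder_inputs w0 W1 Z1 W2 Z2) (W3, Z3) (W4, Z4)) \<and>
     (let E = A1^2 - B1^2; F = (A1^4 + B1^4) - E^2; W4 = 2 * (A1^4 - (e/4) * E^2) - F; Z4 = F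
      in (W4, Z4) \<noteq> (0, 0) \<and> Some (edwards_w d (edwards_add a d P1 P1)) = ext_quot W4 Z4 \<and>
         computes_ladder_step ladder_slp_ii [''e/4'' \<mapsto> e/4]
           (ladder_inputs w0 W1 Z1 W2 Z2) (W3, Z3) (W4, Z4)) \<and>
     ((\<exists>s. s \<noteq> 0 \<and> e * (e - 4) = s^2) \<longleftrightarrow> quad_char (a * (a - d)) = 1) \<and>
     ((\<exists>s. s \<noteq> 0 \<and> e * (e - 4) = s^2) \<longrightarrow>
       (\<exists>r. r^2 = (e - 4) / e) \<and>
       (\<forall>r. r^2 = (e - 4) / e \<longrightarrow>
         (let H1 = (r * A1^2 + B1^2)^2; H2 = (r * A1^2 - B1^2)^2; G = H1 + H2; K = H1 - H2;
              S = (1/r) * K; T = r * K; W4 = 2 * G - S - T; Z4 = T - S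
          in (W4, Z4) \<noteq> (0, 0) \<and> Some (edwards_w d (edwards_add a d P1 P1)) = ext_quot W4 Z4 \<and>
             computes_ladder_step ladder_slp_iii [''r'' \<mapsto> r, ''1/r'' \<mapsto> 1/r]
               (ladder_inputs w0 W1 Z1 W2 Z2) (W3, Z3) (W4, Z4)))) \<and>
     slp_cost cM cS cD ladder_slp_i = 5 * cM + 4 * cS + 1 * cD \<and>
     slp_cost cM cS cD ladder_slp_ii = 3 * cM + 7 * cS + 1 * cD \<and>
     slp_cost cM cS cD ladder_slp_iii = 3 * cM + 6 * cS + 3 * cD"
proof -
  have two: "(2::'a) \<noteq> 0" using assms(1) by (rule two_neq_zero_of_odd_CHAR)
  note four = four_neq_zero[OF two]
  have a: "a \<noteq> 0" and d: "d \<noteq> 0" and a_d: "a - d \<noteq> 0" using assms(2) by auto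
  have e: "e \<noteq> 0" using assms(3) a d four by simp
  have e4: "e - 4 = 4 * (a - d) / d" using assms(3) d by (simp add: field_simps)
  then have e_4: "e - 4 \<noteq> 0" using a_d d four by simp
  note double = edwards_w_double[OF two assms(2,4,8,9,3,12,13) refl]
  have add: "(W3, Z3) \<noteq> (0, 0) \<and> Some (edwards_w d (edwards_add a d P1 P2)) = ext_quot W3 Z3"
    by (rule edwards_w_diff_add[OF two assms(2,4-11) _ _ assms(18,19)]) (simp_all add: assms(12-17))
  have square: "(\<exists>s. s \<noteq> 0 \<and> e * (e - 4) = s^2) \<longleftrightarrow> quad_char (a * (a - d)) = 1"
  proof -
    \<comment> \<open>The two sides differ by a nonzero square, so they lie in the same square
      class.\<close>
    have eq: "e * (e - 4) = (4 / d)^2 * (a * (a - d))"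
      unfolding e4 unfolding assms(3) by (simp add: power2_eq_square)
    have "(\<exists>s. s \<noteq> 0 \<and> e * (e - 4) = s^2) \<longleftrightarrow> (\<exists>y. a * (a - d) = y^2)"
    proof (intro iffI; elim exE conjE)
      fix s assume s: "e * (e - 4) = s^2"
      have "(s * (d / 4))^2 = (4 / d * (d / 4))^2 * (a * (a - d))"
        unfolding power_mult_distrib s[symmetric] eq by (simp only: ac_simps)
      then have "a * (a - d) = (s * (d / 4))^2" using d four by simp
      then show "\<exists>y. a * (a - d) = y^2" ..
    next
      fix y assume "a * (a - d) = y^2"
      then have "e * (e - 4) = (4 / d * y)^2" unfolding eq by (simp only: power_mult_distrib)
      moreover have "e * (e - 4) \<noteq> 0" using e e_4 by simp
      ultimately show "\<exists>s. s \<noteq> 0 \<and> e * (e - 4) = s^2" by (intro exI[of _ "4 / d * y"]) auto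
    qed
    then show ?thesis using a a_d by (simp add: quad_char_def)
  qed
  have root: "\<exists>r. r^2 = (e - 4) / e" if "e * (e - 4) = s^2" for s
  proof -
    have "(s / e)^2 = (e * (e - 4)) / e^2" by (simp add: power_divide that)
    also have "\<dots> = (e - 4) / e" using e by (simp add: power2_eq_square)
    finally show ?thesis ..
  qed
  have step_i: "computes_ladder_step ladder_slp_i [''e/4'' \<mapsto> e/4]
      (ladder_inputs w0 W1 Z1 W2 Z2) (W3, Z3) (W4, Z4)"
    if "E = A1^2 - B1^2" "W4 = E * (A1^2 - (e/4) * E)" "Z4 = A1^2 * B1^2" for E W4 Z4
    unfolding that assms(12-19)
    by (simp add: computes_ladder_step_def ladder_slp_i_def diff_add_slp_def ladder_inputs_def)
  have pow4: "(x^2)^2 = x^4" for x :: 'a by (simp flip: power_mult)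
  have step_ii: "computes_ladder_step ladder_slp_ii [''e/4'' \<mapsto> e/4]
      (ladder_inputs w0 W1 Z1 W2 Z2) (W3, Z3) (W4, F)"
    if "E = A1^2 - B1^2" "F = (A1^4 + B1^4) - E^2" "W4 = 2 * (A1^4 - (e/4) * E^2) - F" for E F W4
    unfolding that assms(12-19)
    by (simp add: computes_ladder_step_def ladder_slp_ii_def diff_add_slp_def ladder_inputs_def pow4)
  have step_iii: "computes_ladder_step ladder_slp_iii [''r'' \<mapsto> r, ''1/r'' \<mapsto> 1/r]
      (ladder_inputs w0 W1 Z1 W2 Z2) (W3, Z3) (2 * (H1 + H2) - S - T, T - S)"
    if "H1 = (r * A1^2 + B1^2)^2" "H2 = (r * A1^2 - B1^2)^2"
      "S = (1/r) * (H1 - H2)" "T = r * (H1 - H2)" for r H1 H2 S T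
    unfolding that assms(12-19)
    by (simp add: computes_ladder_step_def ladder_slp_iii_def diff_add_slp_def ladder_inputs_def)
  have cost: "slp_cost cM cS cD ladder_slp_i = 5 * cM + 4 * cS + 1 * cD"
    "slp_cost cM cS cD ladder_slp_ii = 3 * cM + 7 * cS + 1 * cD"
    "slp_cost cM cS cD ladder_slp_iii = 3 * cM + 6 * cS + 3 * cD"
    by (simp_all add: slp_cost_def ladder_slp_i_def ladder_slp_ii_def ladder_slp_iii_def
        diff_add_slp_def)
  have i: "let E = A1^2 - B1^2; W4 = E * (A1^2 - (e/4) * E); Z4 = A1^2 * B1^2
      in (W4, Z4) \<noteq> (0, 0) \<and> Some (edwards_w d (edwards_add a d P1 P1)) = ext_quot W4 Z4 \<and>
         computes_ladder_step ladder_slp_i [''e/4'' \<mapsto> e/4]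
           (ladder_inputs w0 W1 Z1 W2 Z2) (W3, Z3) (W4, Z4)"
    unfolding Let_def using double[where k = 1] step_i by simp
  have ii: "let E = A1^2 - B1^2; F = (A1^4 + B1^4) - E^2; W4 = 2 * (A1^4 - (e/4) * E^2) - F; Z4 = F
      in (W4, Z4) \<noteq> (0, 0) \<and> Some (edwards_w d (edwards_add a d P1 P1)) = ext_quot W4 Z4 \<and>
         computes_ladder_step ladder_slp_ii [''e/4'' \<mapsto> e/4]
           (ladder_inputs w0 W1 Z1 W2 Z2) (W3, Z3) (W4, Z4)"
  proof -
    define f where "f = e / 4"
    define E where "E = A1^2 - B1^2"
    \<comment> \<open>Variant (ii) obtains the product \<open>2 * A1^2 * B1^2\<close> from squarings
      alone; both outputs are those of variant (i) doubled.\<close>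
    have F: "A1^4 + B1^4 - E^2 = 2 * (A1^2 * B1^2)" unfolding E_def by algebra
    have W: "2 * (A1^4 - f * E^2) - (A1^4 + B1^4 - E^2) = 2 * (E * (A1^2 - f * E))"
      unfolding E_def by algebra
    show ?thesis
      unfolding Let_def E_def[symmetric]
      using double[OF two W[unfolded E_def f_def] F[unfolded E_def]]
        step_ii[OF E_def refl refl]
      unfolding E_def by blast
  qed
  have iii: "let H1 = (r * A1^2 + B1^2)^2; H2 = (r * A1^2 - B1^2)^2; G = H1 + H2; K = H1 - H2;
              S = (1/r) * K; T = r * K; W4 = 2 * G - S - T; Z4 = T - S
          in (W4, Z4) \<noteq> (0, 0) \<and> Some (edwards_w d (edwards_add a d P1 P1)) = ext_quot W4 Z4 \<and>
             computes_ladder_step ladder_slp_iii [''r'' \<mapsto> r, ''1/r'' \<mapsto> 1/r]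
               (ladder_inputs w0 W1 Z1 W2 Z2) (W3, Z3) (W4, Z4)" if r: "r^2 = (e - 4) / e" for r
  proof -
    define H1 where "H1 = (r * A1^2 + B1^2)^2"
    define H2 where "H2 = (r * A1^2 - B1^2)^2"
    define S where "S = (1/r) * (H1 - H2)"
    define T where "T = r * (H1 - H2)"
    define f where "f = e / 4"
    \<comment> \<open>This \<open>k\<close> is \<open>-16/e\<close>, chosen so that
      \<open>r^2 = 1 - 1/f\<close> becomes \<open>4 * r^2 = 4 + k\<close>; then
      \<open>T - S = 4 * (r^2 - 1) * A1^2 * B1^2\<close> has the factor \<open>k\<close>.\<close>
    define k where "k = - 4 / f"
    have f: "f \<noteq> 0" using e four by (simp add: f_def)
    then have k: "k \<noteq> 0" "k * f = - 4" using four by (simp_all add: k_def)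
    have "r \<noteq> 0" using r e e_4 by auto
    have "e = 4 * f" "r^2 * e = e - 4" using r e four by (simp_all add: f_def)
    then have "4 * (r^2 * f - (f - 1)) = 0" by algebra
    then have "r^2 * f - (f - 1) = 0" using four by (metis mult_eq_0_iff)
    then have "f * (4 * r^2 - (4 + k)) = 0" using k(2) by algebra
    then have rk: "4 * r^2 = 4 + k" using f by (metis mult_eq_0_iff eq_iff_diff_eq_0)
    have K: "H1 - H2 = r * (4 * (A1^2 * B1^2))" unfolding H1_def H2_def by algebra
    have S: "S = 4 * (A1^2 * B1^2)" unfolding S_def K using \<open>r \<noteq> 0\<close> by simp
    have T: "T = (4 + k) * (A1^2 * B1^2)" unfolding T_def K using rk by algebra
    have G: "2 * (H1 + H2) = (4 + k) * A1^4 + 4 * B1^4" unfolding H1_def H2_def using rk by algebra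
    have Z: "T - S = k * (A1^2 * B1^2)" unfolding S T by algebra
    \<comment> \<open>With \<open>E = A1^2 - B1^2\<close> the left side is
      \<open>4 * E^2 + k * A1^2 * E\<close>, and \<open>4 = - k * f\<close> brings out the factor
      \<open>k\<close>.\<close>
    have W: "2 * (H1 + H2) - S - T = k * ((A1^2 - B1^2) * (A1^2 - f * (A1^2 - B1^2)))"
      unfolding G S T using k(2) by algebra
    show ?thesis
      unfolding Let_def
      using double[OF k(1) W[unfolded f_def] Z] step_iii[OF H1_def H2_def S_def T_def]
      unfolding S_def T_def H1_def H2_def by blast
  qed
  show ?thesis using add i ii square root iii cost by blast
qed

end
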